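(* Let $\mathscr G=\{\mathsf H_1,\dots,\mathsf H_{n_0}\}$, $n_0\ge1$, be a finite collection of Hénon maps with total degree $D_{\mathscr G}$ and dynamical Green's functions $G_{\mathscr G}^\pm$. Then for every $z\in\mathbb C^2$ $$\sum_{i=1}^{n_0}G_{\mathscr G}^+\circ\mathsf H_i(z)=D_{\mathscr G}\,G_{\mathscr G}^+(z)\quad\text{and}\quad\sum_{i=1}^{n_0}G_{\mathscr G}^-\circ\mathsf H_i^{-1}(z)=D_{\mathscr G}\,G_{\mathscr G}^-(z).$$
   Context: A Hénon map here means a polynomial automorphism of $\mathbb C^2$ of the form $H_1\circ\cdots\circ H_m$, $m\ge1$, where each $H_j(x,y)=(y,p_j(y)-a_jx)$ with $a_j\ne0$ and $p_j$ a polynomial of degree at least $2$; its degree is its degree as a polynomial map. With $d_i=\deg\mathsf H_i$, the total degree is $D_{\mathscr G}=\sum_{i=1}^{n_0}d_i$. $\mathscr G_k$ is the family of all compositions $\mathsf H_{i_1}\circ\cdots\circ\mathsf H_{i_k}$, $1\le i_j\le n_0$; sums over $h\in\mathscr G_k$ run over all $n_0^k$ words. The dynamical Green's functions are the pointwise limits (which exist and are continuous and plurisubharmonic on $\mathbb C^2$) $$G_{\mathscr G}^{+}(z)=\lim_{k\to\infty}\frac1{D_{\mathscr G}^k}\sum_{h\in\mathscr G_k}\log^+\|h(z)\|,\qquad G_{\mathscr G}^{-}(z)=\lim_{k\to\infty}\frac1{D_{\mathscr G}^k}\sum_{h\in\mathscr G_k}\log^+\|h^{-1}(z)\|,$$ where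 $\|\cdot\|$ is the supremum norm and $\log^+x=\max\{\log x,0\}$. *)

theory Defs
  imports Complex_Main "HOL-Computational_Algebra.Polynomial"
begin

text \<open>
  A polynomial in two variables is an element of \<open>\<complex>[y][x]\<close>: the coefficient of \<open>x^i * y^j\<close> in
  \<open>P\<close> is \<open>coeff (coeff P i) j\<close>.
\<close>

definition eval2 :: "complex poly poly \<Rightarrow> complex \<Rightarrow> complex \<Rightarrow> complex" where
  "eval2 P x y = poly (poly P [:x:]) y"

definition total_degree :: "complex poly poly \<Rightarrow> nat" where
  "total_degree P = Max (insert 0 {i + j | i j. coeff (coeff P i) j \<noteq> 0})"

text \<open>
  The two component polynomials of a polynomial self-map of \<open>\<complex> \<times> \<complex>\<close> are determined by the map,
  since \<open>\<complex>\<close> is infinite, so the description below is definite on polynomial maps.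
\<close>

definition polymap_degree :: "(complex \<times> complex \<Rightarrow> complex \<times> complex) \<Rightarrow> nat" where
  "polymap_degree F =
     (THE d. \<exists>P Q. (\<forall>x y. F (x, y) = (eval2 P x y, eval2 Q x y)) \<and>
                   d = max (total_degree P) (total_degree Q))"

definition comp_list :: "('a \<Rightarrow> 'a) list \<Rightarrow> 'a \<Rightarrow> 'a" where
  "comp_list fs = foldr (\<circ>) fs id"

definition elementary_henon ::
    "complex poly \<Rightarrow> complex \<Rightarrow> complex \<times> complex \<Rightarrow> complex \<times> complex" where
  "elementary_henon p a = (\<lambda>(x, y). (y, poly p y - a * x))"

definition henon_map :: "(complex \<times> complex \<Rightarrow> complex \<times> complex) \<Rightarrow> bool" where
  "henon_map F \<longleftrightarrow>
     (\<exists>pas. pas \<noteq> [] \<and> (\<forall>(p, a) \<in> set pas. degree p \<ge> 2 \<and> a \<noteq> 0) \<and>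
            F = comp_list (map (\<lambda>(p, a). elementary_henon p a) pas))"

text \<open>
  A finite collection of maps is an indexed family \<open>H 1, \<dots>, H n\<close>; values of \<open>H\<close> at other indices
  are never used.
\<close>

definition collection_degree ::
    "(nat \<Rightarrow> complex \<times> complex \<Rightarrow> complex \<times> complex) \<Rightarrow> nat \<Rightarrow> nat" where
  "collection_degree H n = (\<Sum>i=1..n. polymap_degree (H i))"

definition words :: "nat \<Rightarrow> nat \<Rightarrow> nat list set" where
  "words n k = {w. length w = k \<and> set w \<subseteq> {1..n}}"

text \<open>The library norm on \<open>\<complex> \<times> \<complex>\<close> is the Euclidean one.\<close>

definition sup_norm :: "complex \<times> complex \<Rightarrow> real" where
  "sup_norm z = max (cmod (fst z)) (cmod (snd z))"

text \<open>Since \<open>ln 0 = 0\<close> in the library, \<open>log_plus 0 = 0\<close>, as it should be.\<close>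

definition log_plus :: "real \<Rightarrow> real" where
  "log_plus x = max (ln x) 0"

definition green_plus ::
    "(nat \<Rightarrow> complex \<times> complex \<Rightarrow> complex \<times> complex) \<Rightarrow> nat \<Rightarrow> complex \<times> complex \<Rightarrow> real" where
  "green_plus H n z =
     lim (\<lambda>k. 1 / real (collection_degree H n) ^ k *
               (\<Sum>w\<in>words n k. log_plus (sup_norm (comp_list (map H w) z))))"

definition green_minus ::
    "(nat \<Rightarrow> complex \<times> complex \<Rightarrow> complex \<times> complex) \<Rightarrow> nat \<Rightarrow> complex \<times> complex \<Rightarrow> real" where
  "green_minus H n z =
     lim (\<lambda>k. 1 / real (collection_degree H n) ^ k *
               (\<Sum>w\<in>words n k. log_plus (sup_norm (inv (comp_list (map H w)) z))))"

end

theory Submission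
  imports Defs
begin

text \<open>
  Splitting off the innermost letter of a word turns the sum over words of length \<open>k + 1\<close> at \<open>z\<close>
  into the sum over \<open>i\<close> of the sums over words of length \<open>k\<close> at \<open>H i z\<close>; so the functional equation
  follows by passing to the limit, once the limits are known to exist.

  For the existence, split off the outermost letter instead. The one-sided estimate
  \<open>log\<^sup>+ \<parallel>H i z\<parallel> \<le> d i * log\<^sup>+ \<parallel>z\<parallel> + C\<close> shows that the averages satisfy
  \<open>a (k + 1) \<le> a k + C' * (n / D) ^ k\<close> with \<open>D \<ge> 2 * n\<close>, and a nonnegative sequence that is
  decreasing up to a summable error converges. No lower estimate is needed. The inverse maps satisfy
  the same estimate, with the product \<open>e\<close> of the degrees of the elementary factors in place of the
  degree of the map. The two agree as far as needed because the second component of \<open>H (0, y)\<close> is a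
  polynomial in \<open>y\<close> of degree exactly \<open>e\<close>, so that the degree of the map is at least \<open>e\<close>.
\<close>

section \<open>Polynomial maps and their degree\<close>

lemma eval2_simps [simp]:
  "eval2 (P + Q) x y = eval2 P x y + eval2 Q x y"
  "eval2 (P - Q) x y = eval2 P x y - eval2 Q x y"
  "eval2 (P * Q) x y = eval2 P x y * eval2 Q x y"
  "eval2 (smult q P) x y = poly q y * eval2 P x y"
  "eval2 [:[:c:]:] x y = c"
  "eval2 [:0, 1:] x y = x"
  "eval2 [:[:0, 1:]:] x y = y"
  by (simp_all add: eval2_def)

lemma eval2_zero_left: "eval2 P 0 y = poly (coeff P 0) y"
  by (simp add: eval2_def poly_0_coeff_0)

text \<open>For each \<open>x\<close> the two polynomials in \<open>y\<close> coincide, so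
  \<open>P - Q\<close>, as a polynomial in \<open>x\<close> with coefficients in \<open>y\<close>,
  has all the constants \<open>[:x:]\<close> as roots.\<close>

lemma eval2_eq_iff: "(\<forall>x y. eval2 P x y = eval2 Q x y) \<longleftrightarrow> P = Q"
proof
  assume eq: "\<forall>x y. eval2 P x y = eval2 Q x y"
  have "poly P [:x:] = poly Q [:x:]" for x
    using eq by (simp add: eval2_def flip: poly_eq_poly_eq_iff) (simp add: fun_eq_iff)
  then have "range (\<lambda>x. [:x:]) \<subseteq> {t. poly (P - Q) t = 0}"
    by auto
  moreover have "infinite (range (\<lambda>x::complex. [:x:]))"
    by (simp add: finite_image_iff inj_on_def infinite_UNIV_char_0)
  ultimately have "infinite {t. poly (P - Q) t = 0}"
    using infinite_super by blast
  then show "P = Q"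
    using poly_roots_finite[of "P - Q"] by auto
qed simp

lemma degree_coeff_0_le_total_degree: "degree (coeff P 0) \<le> total_degree P"
proof (cases "coeff P 0 = 0")
  case False
  \<comment> \<open>\<open>Max\<close> is informative only on finite sets, so the exponents of
    nonzero coefficients are first confined to a finite range.\<close>
  have "{i + j | i j. coeff (coeff P i) j \<noteq> 0}
      \<subseteq> (\<Union>i\<le>degree P. (\<lambda>j. i + j) ` {..degree (coeff P i)})"
    using le_degree coeff_0 coeff_eq_0
    by (fastforce simp: not_less[symmetric])
  then have "finite {i + j | i j. coeff (coeff P i) j \<noteq> 0}"
    by (rule finite_subset) auto
  moreover have "degree (coeff P 0) \<in> {i + j | i j. coeff (coeff P i) j \<noteq> 0}"
    using False leading_coeff_neq_0 by (metis (mono_tags, lifting) add_0 mem_Collect_eq)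
  ultimately show ?thesis
    unfolding total_degree_def by (intro Max_ge) auto
qed simp

lemma polymap_degree_eq:
  assumes "\<And>x y. F (x, y) = (eval2 P x y, eval2 Q x y)"
  shows "polymap_degree F = max (total_degree P) (total_degree Q)"
  unfolding polymap_degree_def
proof (rule the_equality)
  show "\<exists>P' Q'. (\<forall>x y. F (x, y) = (eval2 P' x y, eval2 Q' x y)) \<and>
      max (total_degree P) (total_degree Q) = max (total_degree P') (total_degree Q')"
    using assms by blast
next
  fix d
  assume "\<exists>P' Q'. (\<forall>x y. F (x, y) = (eval2 P' x y, eval2 Q' x y)) \<and>
      d = max (total_degree P') (total_degree Q')"
  then obtain P' Q' where F: "\<forall>x y. F (x, y) = (eval2 P' x y, eval2 Q' x y)"
    and d: "d = max (total_degree P') (total_degree Q')"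
    by blast
  then have "P' = P" "Q' = Q"
    using assms by (simp_all flip: eval2_eq_iff)
  then show "d = max (total_degree P) (total_degree Q)"
    using d by simp
qed

lemma eval2_poly_comp: "\<exists>R. \<forall>x y. eval2 R x y = poly p (eval2 Q x y)"
proof (induction p)
  case 0
  show ?case by (rule exI[of _ 0]) (simp add: eval2_def)
next
  case (pCons a p)
  then obtain R where "\<forall>x y. eval2 R x y = poly p (eval2 Q x y)"
    by blast
  then show ?case
    by (intro exI[of _ "[:[:a:]:] + Q * R"]) simp
qed

section \<open>Compositions of elementary maps\<close>

lemma comp_list_simps [simp]:
  "comp_list [] = id"
  "comp_list (f # fs) = f \<circ> comp_list fs"
  by (simp_all add: comp_list_def)

lemma comp_list_append: "comp_list (fs @ gs) = comp_list fs \<circ> comp_list gs"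
  by (induction fs) (simp_all add: comp_assoc)

lemma bij_comp_list: "(\<And>f. f \<in> set fs \<Longrightarrow> bij f) \<Longrightarrow> bij (comp_list fs)"
  by (induction fs) (simp_all add: bij_comp)

lemma inv_comp_list:
  "(\<And>f. f \<in> set fs \<Longrightarrow> bij f) \<Longrightarrow> inv (comp_list fs) = comp_list (rev (map inv fs))"
proof (induction fs)
  case (Cons f fs)
  then have "inv (f \<circ> comp_list fs) = inv (comp_list fs) \<circ> inv f"
    by (intro o_inv_distrib bij_comp_list) auto
  with Cons show ?case
    by (simp add: comp_list_append del: o_apply)
qed (simp add: inv_id)

definition elementary_inverse ::
    "complex poly \<Rightarrow> complex \<Rightarrow> complex \<times> complex \<Rightarrow> complex \<times> complex" where
  "elementary_inverse p a = (\<lambda>(u, v). ((poly p u - v) / a, u))"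

lemma elementary_henon_bij:
  assumes "a \<noteq> 0"
  shows "bij (elementary_henon p a)" "inv (elementary_henon p a) = elementary_inverse p a"
proof -
  have *: "elementary_inverse p a \<circ> elementary_henon p a = id"
    "elementary_henon p a \<circ> elementary_inverse p a = id"
    using assms by (auto simp: elementary_henon_def elementary_inverse_def fun_eq_iff)
  show "bij (elementary_henon p a)"
    using * by (rule o_bij)
  show "inv (elementary_henon p a) = elementary_inverse p a"
    using * by (intro inv_unique_comp)
qed

text \<open>Supplies the component polynomials with which \<open>polymap_degree_eq\<close> evaluates
  the definite description of the degree.\<close>

lemma henon_composition_poly:
  "\<exists>P Q. \<forall>x y. comp_list (map (\<lambda>(p, a). elementary_henon p a) pas) (x, y)
           = (eval2 P x y, eval2 Q x y)"
proof (induction pas)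
  case Nil
  show ?case
    by (rule exI[of _ "[:0, 1:]"], rule exI[of _ "[:[:0, 1:]:]"]) simp
next
  case (Cons pa pas)
  obtain p a where pa: "pa = (p, a)"
    by (cases pa)
  from Cons obtain P Q where
    PQ: "\<forall>x y. comp_list (map (\<lambda>(p, a). elementary_henon p a) pas) (x, y)
           = (eval2 P x y, eval2 Q x y)"
    by blast
  obtain R where "\<forall>x y. eval2 R x y = poly p (eval2 Q x y)"
    using eval2_poly_comp by blast
  with PQ show ?case
    by - (rule exI[of _ Q], rule exI[of _ "R - [:[:a:]:] * P"], simp add: pa elementary_henon_def)
qed

text \<open>On the line \<open>x = 0\<close> everything is a polynomial in one variable. Since
  \<open>degree g \<ge> 1\<close> and \<open>degree f \<le> degree g\<close>, the degree of
  \<open>pcompose p g\<close> is at least \<open>2 * degree g\<close> and exceeds that of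
  \<open>smult a f\<close>, so the leading term never cancels.\<close>

lemma henon_composition_axis:
  assumes "\<forall>(p, a) \<in> set pas. degree p \<ge> 2"
  shows "\<exists>f g. (\<forall>y. comp_list (map (\<lambda>(p, a). elementary_henon p a) pas) (0, y) = (poly f y, poly g y))
           \<and> degree f \<le> degree g \<and> degree g = (\<Prod>(p, a)\<leftarrow>pas. degree p) \<and> degree g \<ge> 1"
  using assms
proof (induction pas)
  case Nil
  show ?case
    by (rule exI[of _ 0], rule exI[of _ "[:0, 1:]"]) simp
next
  case (Cons pa pas)
  obtain p a where pa: "pa = (p, a)"
    by (cases pa)
  have "\<forall>(p, a) \<in> set pas. degree p \<ge> 2"
    using Cons.prems by simp
  from Cons.IH[OF this] obtain f g where
    fg: "\<forall>y. comp_list (map (\<lambda>(p, a). elementary_henon p a) pas) (0, y) = (poly f y, poly g y)"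
    and deg: "degree f \<le> degree g" "degree g = (\<Prod>(p, a)\<leftarrow>pas. degree p)" "degree g \<ge> 1"
    by blast
  have p: "degree p \<ge> 2"
    using Cons.prems by (simp add: pa)
  define h where "h = pcompose p g - smult a f"
  have "2 * degree g \<le> degree p * degree g"
    using p by (rule mult_le_mono1)
  then have *: "degree g < degree (pcompose p g)"
    using deg by (simp add: degree_pcompose)
  have "degree (smult a f) < degree (pcompose p g)"
    using degree_smult_le[of a f] deg(1) * by linarith
  then have "degree (pcompose p g + smult (- a) f) = degree (pcompose p g)"
    by (intro degree_add_eq_left) simp
  then have h: "degree h = degree p * degree g"
    by (simp add: h_def degree_pcompose)
  show ?case
    using fg deg h *
    by - (rule exI[of _ g], rule exI[of _ h],
      simp add: pa elementary_henon_def h_def poly_pcompose degree_pcompose)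
qed

section \<open>Logarithmic growth\<close>

definition log_height :: "complex \<times> complex \<Rightarrow> real" where
  "log_height z = log_plus (sup_norm z)"

text \<open>Here \<open>d\<close> is only an upper exponent, so a map and its inverse can share
  it.\<close>

definition log_growth :: "(complex \<times> complex \<Rightarrow> complex \<times> complex) \<Rightarrow> nat \<Rightarrow> bool" where
  "log_growth F d \<longleftrightarrow> (\<exists>C\<ge>0. \<forall>z. log_height (F z) \<le> real d * log_height z + C)"

lemma log_height_nonneg [simp]: "0 \<le> log_height z"
  by (simp add: log_height_def log_plus_def)

lemma log_height_le_iff:
  assumes "t \<ge> 0"
  shows "log_height z \<le> t \<longleftrightarrow> cmod (fst z) \<le> exp t \<and> cmod (snd z) \<le> exp t"
\<comment> \<open>Comparing logarithms needs positive arguments, so the origin is treated apart;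
  there \<open>ln 0 = 0\<close> gives height 0.\<close>
proof (cases "sup_norm z = 0")
  case True
  then have "cmod (fst z) \<le> 0" "cmod (snd z) \<le> 0"
    unfolding sup_norm_def by linarith+
  with True assms show ?thesis
    by (simp add: log_height_def log_plus_def)
next
  case False
  then have "sup_norm z > 0"
    by (metis norm_ge_zero sup_norm_def max.coboundedI1 order_less_le)
  then have "log_height z \<le> t \<longleftrightarrow> sup_norm z \<le> exp t"
    using assms by (simp add: log_height_def log_plus_def ln_le_cancel_iff[of _ "exp t", symmetric])
  then show ?thesis
    by (simp add: sup_norm_def)
qed

lemma cmod_le_exp_log_height:
  "cmod x \<le> exp (log_height (x, y))" "cmod y \<le> exp (log_height (x, y))"
  using log_height_le_iff[of "log_height (x, y)" "(x, y)"] by simp_all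

text \<open>Heights are nonnegative, so a larger exponent weakens the bound. This replaces the
  product of the elementary degrees by the degree of the map.\<close>

lemma log_growth_mono: "log_growth F d \<Longrightarrow> d \<le> e \<Longrightarrow> log_growth F e"
  unfolding log_growth_def
  by (meson add_right_mono log_height_nonneg mult_right_mono of_nat_mono order_trans)

lemma log_growth_id: "log_growth id 1"
  by (auto simp: log_growth_def intro: exI[of _ 0])

lemma log_growth_comp:
  assumes "log_growth F d" "log_growth G e"
  shows "log_growth (F \<circ> G) (d * e)"
proof -
  obtain C where C: "C \<ge> 0" "\<And>z. log_height (F z) \<le> real d * log_height z + C"
    using assms(1) by (auto simp: log_growth_def)
  obtain B where B: "B \<ge> 0" "\<And>z. log_height (G z) \<le> real e * log_height z + B"
    using assms(2) by (auto simp: log_growth_def)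
  have "log_height ((F \<circ> G) z) \<le> real (d * e) * log_height z + (real d * B + C)" for z
  proof -
    have "log_height (F (G z)) \<le> real d * log_height (G z) + C"
      by (rule C)
    also have "\<dots> \<le> real d * (real e * log_height z + B) + C"
      by (intro add_right_mono mult_left_mono B) simp
    finally show ?thesis
      by (simp add: algebra_simps)
  qed
  moreover have "real d * B + C \<ge> 0"
    using B C by simp
  ultimately show ?thesis
    unfolding log_growth_def by blast
qed

lemma log_growthI:
  assumes "\<And>z. cmod (fst (F z)) \<le> B * exp (real d * log_height z)"
    and "\<And>z. cmod (snd (F z)) \<le> B * exp (real d * log_height z)"
  shows "log_growth F d"
proof -
  \<comment> \<open>The multiplicative constant becomes an additive one, and \<open>max 1 B\<close>
    makes its logarithm nonnegative.\<close>
  have "log_height (F z) \<le> real d * log_height z + ln (max 1 B)" for z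
  proof -
    have "B * exp (real d * log_height z) \<le> max 1 B * exp (real d * log_height z)"
      by (intro mult_right_mono) auto
    also have "\<dots> = exp (real d * log_height z + ln (max 1 B))"
      by (simp add: exp_add)
    finally show ?thesis
      using assms[of z] by (subst log_height_le_iff) (auto intro: order_trans)
  qed
  then show ?thesis
    unfolding log_growth_def by (intro exI[of _ "ln (max 1 B)"]) simp
qed

text \<open>Horner's recursion: each step costs one factor \<open>exp t\<close>, and
  \<open>t \<ge> 0\<close> lets the exponential absorb the constant coefficient. The free
  \<open>t\<close> can later be the height of a point having \<open>y\<close> as either
  coordinate.\<close>

lemma cmod_poly_le_exp:
  "\<exists>B\<ge>0. \<forall>t\<ge>0. \<forall>y. cmod y \<le> exp t \<longrightarrow> cmod (poly p y) \<le> B * exp (real (degree p) * t)"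
proof (induction p)
  case 0
  show ?case
    by (intro exI[of _ 0]) simp
next
  case (pCons a p)
  then obtain B where "B \<ge> 0"
    and B: "\<And>t y. t \<ge> 0 \<Longrightarrow> cmod y \<le> exp t \<Longrightarrow> cmod (poly p y) \<le> B * exp (real (degree p) * t)"
    by blast
  show ?case
  proof (cases "p = 0")
    \<comment> \<open>Constants are separate because \<open>pCons a 0\<close> has degree 0, so the
      degree does not rise by one.\<close>
    case True
    then show ?thesis
      by (intro exI[of _ "cmod a"]) simp
  next
    case False
    have "cmod (poly (pCons a p) y) \<le> (cmod a + B) * exp (real (degree (pCons a p)) * t)"
      if t: "t \<ge> 0" "cmod y \<le> exp t" for t y
    proof -
      have "cmod (poly (pCons a p) y) \<le> cmod a + cmod y * cmod (poly p y)"
        by (simp add: norm_mult norm_triangle_le)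
      also have "cmod y * cmod (poly p y) \<le> exp t * (B * exp (real (degree p) * t))"
        using t B by (intro mult_mono) auto
      also have "\<dots> = B * exp (real (degree (pCons a p)) * t)"
        using False by (simp add: distrib_right exp_add)
      finally have "cmod (poly (pCons a p) y) \<le> cmod a * 1 + B * exp (real (degree (pCons a p)) * t)"
        by simp
      also have "cmod a * 1 \<le> cmod a * exp (real (degree (pCons a p)) * t)"
        using t by (intro mult_left_mono) auto
      finally show ?thesis
        by (simp only: distrib_right)
    qed
    then show ?thesis
      using \<open>B \<ge> 0\<close> by (intro exI[of _ "cmod a + B"]) auto
  qed
qed

lemma log_growth_elementary:
  assumes "degree p \<ge> 1"
  shows "log_growth (elementary_henon p a) (degree p)"
    and "log_growth (elementary_inverse p a) (degree p)"
proof -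
  obtain B where "B \<ge> 0"
    and B: "\<And>t y. t \<ge> 0 \<Longrightarrow> cmod y \<le> exp t \<Longrightarrow> cmod (poly p y) \<le> B * exp (real (degree p) * t)"
    using cmod_poly_le_exp[of p] by blast
  let ?E = "\<lambda>z. exp (real (degree p) * log_height z)"
  have E: "cmod x \<le> ?E (x, y)" "cmod y \<le> ?E (x, y)" for x y
  proof -
    have "1 * log_height (x, y) \<le> real (degree p) * log_height (x, y)"
      using assms by (intro mult_right_mono) auto
    then have "exp (log_height (x, y)) \<le> ?E (x, y)"
      by simp
    then show "cmod x \<le> ?E (x, y)" "cmod y \<le> ?E (x, y)"
      using cmod_le_exp_log_height order_trans by blast+
  qed
  have P: "cmod (poly p x) \<le> B * ?E (x, y)" "cmod (poly p y) \<le> B * ?E (x, y)" for x y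
    using B cmod_le_exp_log_height by simp_all
  show "log_growth (elementary_henon p a) (degree p)"
  \<comment> \<open>The summand 1 serves the component \<open>y\<close>, and
    \<open>B + cmod a\<close> serves \<open>poly p y - a * x\<close>.\<close>
  proof (rule log_growthI[where B = "1 + B + cmod a"])
    fix z :: "complex \<times> complex"
    obtain x y where z: "z = (x, y)" by (cases z)
    have "1 * ?E z \<le> (1 + B + cmod a) * ?E z"
      using \<open>B \<ge> 0\<close> by (intro mult_right_mono) auto
    then show "cmod (fst (elementary_henon p a z)) \<le> (1 + B + cmod a) * ?E z"
      using order_trans[OF E(2)[of y x]] by (simp add: z elementary_henon_def)
    have "cmod (poly p y - a * x) \<le> cmod (poly p y) + cmod a * cmod x"
      by (metis norm_mult norm_triangle_ineq4)
    also have "\<dots> \<le> B * ?E z + cmod a * ?E z"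
      unfolding z by (intro add_mono mult_left_mono P E) simp
    also have "\<dots> \<le> (1 + B + cmod a) * ?E z"
      by (simp add: distrib_right)
    finally show "cmod (snd (elementary_henon p a z)) \<le> (1 + B + cmod a) * ?E z"
      by (simp add: z elementary_henon_def)
  qed
  show "log_growth (elementary_inverse p a) (degree p)"
  proof (rule log_growthI[where B = "1 + (B + 1) / cmod a"])
    fix z :: "complex \<times> complex"
    obtain x y where z: "z = (x, y)" by (cases z)
    have "cmod (poly p x - y) \<le> cmod (poly p x) + cmod y"
      by (rule norm_triangle_ineq4)
    also have "\<dots> \<le> (B + 1) * ?E z"
      using P(1)[of x y] E(2)[of y x] by (simp add: z algebra_simps)
    \<comment> \<open>For \<open>a = 0\<close> both quotients have the default value 0, so the bound
      covers that case too.\<close>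
    finally have "cmod ((poly p x - y) / a) \<le> (B + 1) * ?E z / cmod a"
      by (simp add: norm_divide divide_right_mono)
    then show "cmod (fst (elementary_inverse p a z)) \<le> (1 + (B + 1) / cmod a) * ?E z"
      by (simp add: z elementary_inverse_def distrib_right add_increasing)
    have "1 * ?E z \<le> (1 + (B + 1) / cmod a) * ?E z"
      using \<open>B \<ge> 0\<close> by (intro mult_right_mono) auto
    then show "cmod (snd (elementary_inverse p a z)) \<le> (1 + (B + 1) / cmod a) * ?E z"
      using order_trans[OF E(1)[of x y]] by (simp add: z elementary_inverse_def)
  qed
qed

text \<open>Inversion reverses the order of composition, but the product of the degrees commutes, so
  both directions get the same exponent. Bijectivity is carried along for the inverse of a
  composite.\<close>

lemma log_growth_henon_composition:
  assumes "\<forall>(p, a) \<in> set pas. degree p \<ge> 2 \<and> a \<noteq> 0"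
  defines "F \<equiv> comp_list (map (\<lambda>(p, a). elementary_henon p a) pas)"
  shows "bij F \<and> log_growth F (\<Prod>(p, a)\<leftarrow>pas. degree p)
    \<and> log_growth (inv F) (\<Prod>(p, a)\<leftarrow>pas. degree p)"
  using assms(1) unfolding F_def
proof (induction pas)
  case Nil
  then show ?case
    using log_growth_id bij_id by (simp add: inv_id del: id_apply flip: id_def)
next
  case (Cons pa pas)
  obtain p a where pa: "pa = (p, a)"
    by (cases pa)
  define G where "G = comp_list (map (\<lambda>(p, a). elementary_henon p a) pas)"
  define e where "e = (\<Prod>(p, a)\<leftarrow>pas. degree p)"
  have p: "degree p \<ge> 1" "a \<noteq> 0"
    using Cons.prems by (auto simp: pa)
  have G: "bij G" "log_growth G e" "log_growth (inv G) e"
    using Cons by (auto simp: G_def e_def)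
  have inv: "inv (elementary_henon p a \<circ> G) = inv G \<circ> elementary_inverse p a"
    using o_inv_distrib elementary_henon_bij p G by metis
  have "bij (elementary_henon p a \<circ> G)"
    using elementary_henon_bij p G by (intro bij_comp)
  moreover have "log_growth (elementary_henon p a \<circ> G) (degree p * e)"
    using G p by (intro log_growth_comp log_growth_elementary)
  moreover have "log_growth (inv (elementary_henon p a \<circ> G)) (e * degree p)"
    unfolding inv using G p by (intro log_growth_comp log_growth_elementary)
  ultimately show ?case
    by (simp add: pa G_def e_def mult.commute del: o_apply)
qed

lemma henon_map_growth:
  assumes "henon_map F"
  shows "bij F" "log_growth F (polymap_degree F)" "log_growth (inv F) (polymap_degree F)"
    "polymap_degree F \<ge> 2"
proof -
  obtain pas where pas: "pas \<noteq> []" "\<forall>(p, a) \<in> set pas. degree p \<ge> 2 \<and> a \<noteq> 0"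
    and F: "F = comp_list (map (\<lambda>(p, a). elementary_henon p a) pas)"
    using assms by (auto simp: henon_map_def)
  define e where "e = (\<Prod>(p, a)\<leftarrow>pas. degree p)"
  have deg: "\<forall>(p, a) \<in> set pas. degree p \<ge> 2"
    using pas(2) by auto
  obtain f g where fg: "\<And>y. F (0, y) = (poly f y, poly g y)" and g: "degree g = e"
    using henon_composition_axis[OF deg] unfolding F e_def by blast
  obtain P Q where PQ: "\<And>x y. F (x, y) = (eval2 P x y, eval2 Q x y)"
    using henon_composition_poly[of pas] by (auto simp: F)
  \<comment> \<open>At \<open>x = 0\<close> only the part of \<open>Q\<close> free of
    \<open>x\<close> survives. It equals \<open>g\<close>, so its degree \<open>e\<close> bounds the
    total degree of \<open>Q\<close> from below.\<close>
  have "poly (coeff Q 0) = poly g"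
    using fg PQ[of 0] by (simp add: eval2_zero_left fun_eq_iff)
  then have "coeff Q 0 = g"
    by (simp add: poly_eq_poly_eq_iff)
  then have e: "e \<le> polymap_degree F"
    using degree_coeff_0_le_total_degree[of Q] g by (simp add: polymap_degree_eq[OF PQ])
  obtain pa qas where cons: "pas = pa # qas"
    using pas(1) by (cases pas) auto
  \<comment> \<open>The tail \<open>qas\<close> may be empty; what matters is that its product of
    degrees is positive, so that the first factor forces \<open>e \<ge> 2\<close>.\<close>
  have pos: "(\<Prod>(p, a)\<leftarrow>qas. degree p) \<ge> 1"
    using henon_composition_axis[of qas] deg unfolding cons by fastforce
  have "2 * 1 \<le> degree (fst pa) * (\<Prod>(p, a)\<leftarrow>qas. degree p)"
    using pas(2) pos by (intro mult_le_mono) (auto simp: cons)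
  then have "2 \<le> e"
    by (simp add: e_def cons case_prod_unfold)
  with e show "polymap_degree F \<ge> 2"
    by simp
  show "bij F" "log_growth F (polymap_degree F)" "log_growth (inv F) (polymap_degree F)"
    using log_growth_henon_composition[OF pas(2)] log_growth_mono e
    unfolding F e_def by blast+
qed

section \<open>Sums over words\<close>

lemma card_words: "card (words n k) = n ^ k"
  using card_lists_length_eq[of "{1..n}" k] by (simp add: words_def conj_commute)

lemma rev_words: "rev ` words n k = words n k"
proof
  show "rev ` words n k \<subseteq> words n k"
    by (auto simp: words_def)
  show "words n k \<subseteq> rev ` words n k"
  proof
    fix w
    assume "w \<in> words n k"
    then have "rev w \<in> words n k"
      by (simp add: words_def)
    then show "w \<in> rev ` words n k"
      by force
  qed
qed

text \<open>Reversal permutes the words. This serves both to pass from first to last letters and to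
  absorb the reversed order in inverses of compositions.\<close>

lemma sum_words_rev: "(\<Sum>w\<in>words n k. f (rev w)) = (\<Sum>w\<in>words n k. f w)"
  using sum.reindex[of rev "words n k" f] by (simp add: rev_words)

lemma sum_words_Cons:
  "(\<Sum>w\<in>words n (Suc k). f w) = (\<Sum>i=1..n. \<Sum>w\<in>words n k. f (i # w))"
proof -
  have "words n (Suc k) = (\<lambda>(i, w). i # w) ` ({1..n} \<times> words n k)"
    by (auto simp: words_def length_Suc_conv image_iff)
  moreover have "inj_on (\<lambda>(i, w). i # w) ({1..n} \<times> words n k)"
    by (auto simp: inj_on_def)
  ultimately show ?thesis
    by (simp add: sum.reindex sum.cartesian_product case_prod_unfold)
qed

lemma sum_words_snoc:
  "(\<Sum>w\<in>words n (Suc k). f w) = (\<Sum>i=1..n. \<Sum>w\<in>words n k. f (w @ [i]))"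
proof -
  have "(\<Sum>w\<in>words n (Suc k). f w) = (\<Sum>i=1..n. \<Sum>w\<in>words n k. f (rev (i # w)))"
    using sum_words_rev[of f n "Suc k"] sum_words_Cons[of "\<lambda>w. f (rev w)" n k] by simp
  also have "\<dots> = (\<Sum>i=1..n. \<Sum>w\<in>words n k. f (rev w @ [i]))"
    by simp
  also have "\<dots> = (\<Sum>i=1..n. \<Sum>w\<in>words n k. f (w @ [i]))"
    by (intro sum.cong refl sum_words_rev[of "\<lambda>w. f (w @ [_])"])
  finally show ?thesis .
qed

section \<open>Convergence and the functional equation\<close>

text \<open>The geometric tail \<open>C / (1 - r) * r ^ k\<close> bounds all that \<open>a\<close>
  can still gain after index \<open>k\<close>. Adding it gives a decreasing nonnegative sequence,
  and the added term tends to 0.\<close>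

lemma convergent_almost_decreasing:
  fixes a :: "nat \<Rightarrow> real"
  assumes "0 \<le> r" "r < 1" "0 \<le> C"
    and nonneg: "\<And>k. 0 \<le> a k"
    and step: "\<And>k. a (Suc k) \<le> a k + C * r ^ k"
  shows "convergent a"
proof -
  define b where "b k = a k + C / (1 - r) * r ^ k" for k
  have "b (Suc k) \<le> b k" for k
  proof -
    have "C * r ^ k + C / (1 - r) * r ^ Suc k = C / (1 - r) * r ^ k"
      using assms(2) by (simp add: field_simps)
    with step[of k] show ?thesis
      unfolding b_def by linarith
  qed
  then have "decseq b"
    by (rule decseq_SucI)
  moreover have "0 \<le> b k" for k
    using assms by (simp add: b_def)
  ultimately obtain L where "b \<longlonglongrightarrow> L"
    using decseq_convergent[of b 0] by blast
  moreover have "(\<lambda>k. C / (1 - r) * r ^ k) \<longlonglongrightarrow> C / (1 - r) * 0"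
    using assms by (intro tendsto_intros LIMSEQ_realpow_zero)
  ultimately have "(\<lambda>k. b k - C / (1 - r) * r ^ k) \<longlonglongrightarrow> L - C / (1 - r) * 0"
    by (rule tendsto_diff)
  then show ?thesis
    unfolding b_def convergent_def by auto
qed

text \<open>Family and normalisation are parameters, so that one argument serves the maps and their
  inverses.\<close>

definition word_average ::
    "(nat \<Rightarrow> complex \<times> complex \<Rightarrow> complex \<times> complex) \<Rightarrow> nat \<Rightarrow> real \<Rightarrow> complex \<times> complex \<Rightarrow> nat \<Rightarrow> real"
  where "word_average F n D z k =
    1 / D ^ k * (\<Sum>w\<in>words n k. log_height (comp_list (map F w) z))"

lemma convergent_word_average:
  assumes "n \<ge> 1"
    and growth: "\<And>i. i \<in> {1..n} \<Longrightarrow> log_growth (F i) (d i)"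
    and deg: "\<And>i. i \<in> {1..n} \<Longrightarrow> d i \<ge> 2"
  shows "convergent (word_average F n (real (\<Sum>i=1..n. d i)) z)"
proof -
  define D where "D = real (\<Sum>i=1..n. d i)"
  have "(\<Sum>i=1..n. 2) \<le> (\<Sum>i=1..n. d i)"
    by (intro sum_mono deg)
  then have "real (2 * n) \<le> D"
    unfolding D_def by (intro of_nat_mono) simp
  then have D: "real n < D" "0 < D"
    using assms(1) by simp_all
  have "\<forall>i\<in>{1..n}. \<exists>c. c \<ge> 0 \<and> (\<forall>z. log_height (F i z) \<le> real (d i) * log_height z + c)"
    using growth by (auto simp: log_growth_def)
  then obtain c where c: "\<And>i. i \<in> {1..n} \<Longrightarrow> c i \<ge> 0"
    "\<And>i z. i \<in> {1..n} \<Longrightarrow> log_height (F i z) \<le> real (d i) * log_height z + c i"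
    by metis
  define C where "C = (\<Sum>i=1..n. c i)"
  have "C \<ge> 0"
    unfolding C_def by (intro sum_nonneg c)
  define S where "S k = (\<Sum>w\<in>words n k. log_height (comp_list (map F w) z))" for k
  have avg: "word_average F n D z k = S k / D ^ k" for k
    by (simp add: word_average_def S_def)
  \<comment> \<open>Each of the \<open>n ^ k\<close> words contributes an error \<open>c i\<close>
    for every \<open>i\<close>; division by \<open>D ^ Suc k\<close> turns the total into
    \<open>C / D * (n / D) ^ k\<close>.\<close>
  have S: "S (Suc k) \<le> D * S k + real n ^ k * C" for k
  proof -
    have "S (Suc k) = (\<Sum>i=1..n. \<Sum>w\<in>words n k. log_height (F i (comp_list (map F w) z)))"
      by (simp add: S_def sum_words_Cons)
    also have "\<dots> \<le> (\<Sum>i=1..n. \<Sum>w\<in>words n k. real (d i) * log_height (comp_list (map F w) z) + c i)"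
      by (intro sum_mono c)
    also have "\<dots> = (\<Sum>i=1..n. real (d i) * S k + real n ^ k * c i)"
      by (simp add: S_def sum.distrib sum_distrib_left card_words)
    also have "\<dots> = D * S k + real n ^ k * C"
      by (simp add: D_def C_def sum.distrib sum_distrib_left sum_distrib_right)
    finally show ?thesis .
  qed
  have "convergent (word_average F n D z)"
  proof (rule convergent_almost_decreasing[where r = "real n / D" and C = "C / D"])
    show "0 \<le> real n / D" "real n / D < 1" "0 \<le> C / D"
      using D \<open>C \<ge> 0\<close> by simp_all
    show "0 \<le> word_average F n D z k" for k
      unfolding avg S_def using D by (intro divide_nonneg_nonneg sum_nonneg) auto
    show "word_average F n D z (Suc k) \<le> word_average F n D z k + C / D * (real n / D) ^ k" for k
    proof -
      have "S (Suc k) / D ^ Suc k \<le> (D * S k + real n ^ k * C) / D ^ Suc k"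
        using D S by (intro divide_right_mono) auto
      also have "\<dots> = S k / D ^ k + C / D * (real n / D) ^ k"
        using D by (simp add: field_simps)
      finally show ?thesis
        by (simp add: avg)
    qed
  qed
  then show ?thesis
    by (simp add: D_def)
qed

text \<open>Convergence is assumed at every point because \<open>lim\<close> is informative only for
  convergent sequences and is taken at the points \<open>F i z\<close> as well.\<close>

lemma word_average_functional_equation:
  assumes "D \<noteq> 0" and conv: "\<And>z. convergent (word_average F n D z)"
  shows "(\<Sum>i=1..n. lim (word_average F n D (F i z))) = D * lim (word_average F n D z)"
proof -
  have lim: "word_average F n D z \<longlonglongrightarrow> lim (word_average F n D z)" for z
    using conv by (simp add: convergent_LIMSEQ_iff)
  \<comment> \<open>The equation is exact before the limit: the last letter of a word acts first on
    \<open>z\<close>, and the factor \<open>D\<close> compensates for the exponent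
    \<open>Suc k\<close>.\<close>
  have step: "(\<Sum>i=1..n. word_average F n D (F i z) k) = D * word_average F n D z (Suc k)" for k
    using assms(1) by (simp add: word_average_def sum_words_snoc comp_list_append flip: sum_divide_distrib)
  have "(\<lambda>k. \<Sum>i=1..n. word_average F n D (F i z) k) \<longlonglongrightarrow> (\<Sum>i=1..n. lim (word_average F n D (F i z)))"
    by (intro tendsto_sum lim)
  moreover have "(\<lambda>k. D * word_average F n D z (Suc k)) \<longlonglongrightarrow> D * lim (word_average F n D z)"
    by (intro tendsto_mult_left LIMSEQ_Suc lim)
  ultimately show ?thesis
    unfolding step by (rule LIMSEQ_unique)
qed

lemma green_plus_eq:
  "green_plus H n z = lim (word_average H n (real (collection_degree H n)) z)"
  by (simp add: green_plus_def word_average_def[abs_def] log_height_def)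

text \<open>Inverting a composition of bijections reverses its word, which a sum over all words of a
  given length does not see.\<close>

lemma green_minus_eq:
  assumes "\<And>i. i \<in> {1..n} \<Longrightarrow> bij (H i)"
  shows "green_minus H n z = lim (word_average (\<lambda>i. inv (H i)) n (real (collection_degree H n)) z)"
proof -
  have "(\<Sum>w\<in>words n k. log_plus (sup_norm (inv (comp_list (map H w)) z)))
      = (\<Sum>w\<in>words n k. log_height (comp_list (map (\<lambda>i. inv (H i)) w) z))" for k
  proof -
    have "inv (comp_list (map H w)) = comp_list (map (\<lambda>i. inv (H i)) (rev w))" if "w \<in> words n k" for w
      using that assms by (subst inv_comp_list) (auto simp: words_def rev_map comp_def)
    then have "(\<Sum>w\<in>words n k. log_plus (sup_norm (inv (comp_list (map H w)) z)))
      = (\<Sum>w\<in>words n k. log_height (comp_list (map (\<lambda>i. inv (H i)) (rev w)) z))"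
      by (intro sum.cong) (auto simp: log_height_def)
    also have "\<dots> = (\<Sum>w\<in>words n k. log_height (comp_list (map (\<lambda>i. inv (H i)) w) z))"
      by (rule sum_words_rev)
    finally show ?thesis .
  qed
  then show ?thesis
    by (simp add: green_minus_def word_average_def[abs_def])
qed

theorem corollary1p4:
  fixes H :: "nat \<Rightarrow> complex \<times> complex \<Rightarrow> complex \<times> complex"
    and n0 :: nat
    and z :: "complex \<times> complex"
  assumes "n0 \<ge> 1"
    and "\<And>i. i \<in> {1..n0} \<Longrightarrow> henon_map (H i)"
  shows "(\<Sum>i=1..n0. green_plus H n0 (H i z)) = real (collection_degree H n0) * green_plus H n0 z
       \<and> (\<Sum>i=1..n0. green_minus H n0 (inv (H i) z)) = real (collection_degree H n0) * green_minus H n0 z"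
proof -
  note henon = henon_map_growth[OF assms(2)]
  let ?D = "real (collection_degree H n0)"
  \<comment> \<open>As \<open>n0 \<ge> 1\<close>, the map \<open>H 1\<close> belongs to the family;
    its degree is at least 2, so \<open>?D\<close> is nonzero.\<close>
  have "polymap_degree (H 1) \<le> collection_degree H n0"
    unfolding collection_degree_def using assms(1) by (intro member_le_sum) auto
  then have D: "?D \<noteq> 0"
    using henon(4)[of 1] assms(1) by simp
  \<comment> \<open>Both families have the growth exponents \<open>polymap_degree (H i)\<close>,
    whose sum is the common normalisation.\<close>
  have "convergent (word_average H n0 ?D z)"
    "convergent (word_average (\<lambda>i. inv (H i)) n0 ?D z)" for z
    unfolding collection_degree_def using assms(1) henon by (intro convergent_word_average; simp)+
  then show ?thesis
    using word_average_functional_equation[OF D, of H n0 z]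
      word_average_functional_equation[OF D, of "\<lambda>i. inv (H i)" n0 z]
    by (simp only: green_plus_eq green_minus_eq[where H = H and n = n0, OF henon(1)])
qed

end
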